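(* For $n\ge2$ define polynomials $B_n(t,x)$ by $B_2(t,x)=tx(1-x)^2$ and $B_{n+1}(t,x)=tx^{n+1}B_n(t,x)+tx(1-x)^n(1-x^n)$. Then $$S(12\cdots n;t,x)=\frac{t^n x^{\binom{n+1}{2}}}{(1-x)^n-B_n(t,x)}.$$
   Context: $\mathbb{P}$ is the positive integers; $\mathbb{P}^*$ the finite words over $\mathbb{P}$. Generalized factor order: $u\le w$ iff there is a factor $w'$ of $w$ (consecutive letters) with $|w'|=|u|$ and $u_i\le w'_i$ for all $i$; such $w'$ is an embedding. $\mathcal{S}(u)$ is the set of $w\ge u$ such that every embedding of $u$ into $w$ is a suffix of $w$. The weight of $w=w_1\cdots w_\ell$ is $t^\ell x^{w_1+\cdots+w_\ell}$, and $S(u;t,x)=\sum_{w\in\mathcal{S}(u)}\mathrm{wt}(w)$. $12\cdots n$ is the word with letters $1,2,\ldots,n$ in increasing order. *)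

theory Defs
  imports "HOL-Computational_Algebra.Formal_Power_Series"
begin

unbundle fps_syntax

section \<open>Generalized factor order\<close>

definition words :: "nat list set" where
  "words = lists {1..}"

text \<open>
  An embedding of \<open>u\<close> into \<open>w\<close> is an \<^emph>\<open>occurrence\<close> of a factor \<open>v\<close>, that is, it includes the
  position of \<open>v\<close> in \<open>w\<close>: the same word may occur several times as a factor, and these
  occurrences count as different embeddings.
\<close>

definition is_embedding :: "nat list \<Rightarrow> nat list \<Rightarrow> nat list \<Rightarrow> nat list \<Rightarrow> nat list \<Rightarrow> bool" where
  "is_embedding u w a v b \<longleftrightarrow> w = a @ v @ b \<and> list_all2 (\<le>) u v"

definition factor_le :: "nat list \<Rightarrow> nat list \<Rightarrow> bool" where
  "factor_le u w \<longleftrightarrow> (\<exists>a v b. is_embedding u w a v b)"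

definition suffix_words :: "nat list \<Rightarrow> nat list set" where
  "suffix_words u = {w \<in> words. factor_le u w \<and> (\<forall>a v b. is_embedding u w a v b \<longrightarrow> b = [])}"


section \<open>Bivariate generating functions\<close>

text \<open>
  Series in \<open>t\<close> and \<open>x\<close> are series in \<open>t\<close> whose coefficients are series in \<open>x\<close>:
  \<open>F $ i $ j\<close> is the coefficient of \<open>t\<^sup>i x\<^sup>j\<close>. The scalars are rational so that the library
  division on \<open>rat fps fps\<close> inverts every series whose constant term is nonzero
  (see \<open>bivariate_divide_mult\<close> below).
\<close>

abbreviation tvar :: "rat fps fps" where
  "tvar \<equiv> fps_X"

abbreviation xvar :: "rat fps fps" where
  "xvar \<equiv> fps_const fps_X"

definition wt :: "nat list \<Rightarrow> rat fps fps" where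
  "wt w = tvar ^ length w * xvar ^ sum_list w"

text \<open>
  The sum of a family of series, each coefficient being a sum over the finitely many
  members that contribute to it. The sum is meaningful only for families that satisfy this
  finiteness condition; \<open>formally_summable_wt\<close> shows that it holds for weights of words.
\<close>

definition formally_summable :: "('a \<Rightarrow> rat fps fps) \<Rightarrow> 'a set \<Rightarrow> bool" where
  "formally_summable f A \<longleftrightarrow> (\<forall>i j. finite {a \<in> A. f a $ i $ j \<noteq> 0})"

definition formal_sum :: "('a \<Rightarrow> rat fps fps) \<Rightarrow> 'a set \<Rightarrow> rat fps fps" where
  "formal_sum f A = Abs_fps (\<lambda>i. Abs_fps (\<lambda>j. \<Sum>a\<in>{a \<in> A. f a $ i $ j \<noteq> 0}. f a $ i $ j))"

definition S :: "nat list \<Rightarrow> rat fps fps" where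
  "S u = formal_sum wt (suffix_words u)"

lemma wt_nth: "wt w $ i $ j = (if length w = i \<and> sum_list w = j then 1 else 0)"
  by (simp add: wt_def fps_const_power fps_X_power_mult_nth fps_X_power_nth)

lemma formally_summable_wt:
  assumes "A \<subseteq> words"
  shows "formally_summable wt A"
  unfolding formally_summable_def
proof (intro allI)
  fix i j
  have "{w \<in> A. wt w $ i $ j \<noteq> 0} \<subseteq> {w. set w \<subseteq> {..j} \<and> length w = i}"
    by (auto simp: wt_nth split: if_splits intro: member_le_sum_list)
  then show "finite {w \<in> A. wt w $ i $ j \<noteq> 0}"
    by (rule finite_subset) (simp add: finite_lists_length_eq)
qed

lemma bivariate_divide_mult:
  fixes f g :: "rat fps fps"
  assumes "g $ 0 $ 0 \<noteq> 0"
  shows "f / g * g = f"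
proof -
  have g0: "g $ 0 \<noteq> 0"
    using assms by auto
  have "g $ 0 * inverse (g $ 0) = 1"
    using assms by (rule inverse_mult_eq_1')
  then have "g * inverse g = 1"
    using fps_right_inverse[of g "inverse (g $ 0)"] by (simp only: fps_inverse_def)
  then show ?thesis
    using fps_divide_unit[OF g0, of f] by (simp add: mult.assoc mult.commute[of "inverse g"])
qed


section \<open>The polynomials in the denominator\<close>

text \<open>
  The polynomials are evaluated at elements \<open>t\<close>, \<open>x\<close> of an arbitrary commutative ring. They
  are defined for \<open>n \<ge> 2\<close> only; the values at \<open>0\<close> and \<open>1\<close> are irrelevant.
\<close>

fun B :: "nat \<Rightarrow> 'a::comm_ring_1 \<Rightarrow> 'a \<Rightarrow> 'a" where
  "B 0 t x = 0"
| "B (Suc 0) t x = 0"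
| "B (Suc (Suc 0)) t x = t * x * (1 - x)\<^sup>2"
| "B (Suc (Suc (Suc k))) t x =
    (let n = Suc (Suc k) in t * x ^ (n + 1) * B n t x + t * x * (1 - x) ^ n * (1 - x ^ n))"

lemma B_2: "B 2 t x = t * x * (1 - x)\<^sup>2"
  by (simp add: numeral_2_eq_2)

lemma B_rec:
  assumes "n \<ge> 2"
  shows "B (n + 1) t x = t * x ^ (n + 1) * B n t x + t * x * (1 - x) ^ n * (1 - x ^ n)"
proof -
  obtain k where "n = Suc (Suc k)"
    using assms by (metis add_2_eq_Suc le_iff_add)
  then show ?thesis
    by (simp only: Suc_eq_plus1[symmetric] B.simps(4) Let_def)
qed

lemma B_tvar_nth_0: "B n tvar x $ 0 = 0"
  by (induction n tvar x rule: B.induct) (simp_all add: Let_def mult.assoc)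

lemma denominator_unit: "((1 - xvar) ^ n - B n tvar xvar) $ 0 $ 0 = 1"
  by (simp add: B_tvar_nth_0 fps_power_zeroth)

end

theory Submission
  imports Defs
begin

text \<open>
  Reading a word from left to right, let the state be the largest \<open>k\<close> such that the last \<open>k\<close>
  letters dominate \<open>12\<cdots>k\<close>. A letter \<open>m\<close> moves state \<open>k\<close> to \<open>min (k + 1) m\<close>, and the words
  counted by \<open>S(12\<cdots>n)\<close> are those that reach state \<open>n\<close> for the first time at their end. Let
  \<open>F\<^sub>k\<close> be the generating function of the words leading from state \<open>k\<close> to the first visit of
  \<open>n\<close>. States \<open>k - 1\<close> and \<open>k\<close> treat letters up to \<open>k\<close> alike, and larger letters move them to
  \<open>k\<close> and \<open>k + 1\<close>, so \<open>(1 - x) (F\<^sub>k - F\<^sub>k\<^sub>-\<^sub>1) = t x\<^sup>k\<^sup>+\<^sup>1 (F\<^sub>k\<^sub>+\<^sub>1 - F\<^sub>k)\<close>. By induction, \<open>F\<^sub>k\<close> times the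
  weight of \<open>12\<cdots>k\<close> is \<open>((1 - x)\<^sup>k - B\<^sub>k) F\<^sub>0\<close>; the theorem is the case \<open>k = n\<close>, where \<open>F\<^sub>n = 1\<close>.
\<close>

section \<open>Generating functions of languages\<close>

abbreviation gf :: "nat list set \<Rightarrow> rat fps fps" where
  "gf A \<equiv> formal_sum wt A"

abbreviation slice :: "nat list set \<Rightarrow> nat \<Rightarrow> nat \<Rightarrow> nat list set" where
  "slice A i j \<equiv> {w \<in> A. length w = i \<and> sum_list w = j}"

lemma gf_nth: "gf A $ i $ j = of_nat (card (slice A i j))"
proof -
  have "{w \<in> A. wt w $ i $ j \<noteq> 0} = slice A i j"
    by (auto simp: wt_nth)
  then show ?thesis
    by (simp add: formal_sum_def wt_nth)
qed

lemma finite_slice: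
  assumes "A \<subseteq> words"
  shows "finite (slice A i j)"
proof -
  have "slice A i j = {w \<in> A. wt w $ i $ j \<noteq> 0}"
    by (auto simp: wt_nth)
  then show ?thesis
    using formally_summable_wt[OF assms] by (simp add: formally_summable_def)
qed

lemma gf_Un:
  assumes "A \<subseteq> words" "A' \<subseteq> words" "A \<inter> A' = {}"
  shows "gf (A \<union> A') = gf A + gf A'"
proof (intro fps_ext)
  fix i j
  have "slice (A \<union> A') i j = slice A i j \<union> slice A' i j"
    by auto
  moreover have "card (slice A i j \<union> slice A' i j) = card (slice A i j) + card (slice A' i j)"
    using assms by (intro card_Un_disjoint finite_slice) auto
  ultimately show "gf (A \<union> A') $ i $ j = (gf A + gf A') $ i $ j"
    by (simp add: gf_nth)
qed

lemma gf_image: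
  assumes "inj_on f A"
    and len: "\<And>w. w \<in> A \<Longrightarrow> length (f w) = p + length w"
    and sum: "\<And>w. w \<in> A \<Longrightarrow> sum_list (f w) = q + sum_list w"
  shows "gf (f ` A) = tvar ^ p * xvar ^ q * gf A"
proof (intro fps_ext)
  fix i j
  have rhs: "(tvar ^ p * xvar ^ q * gf A) $ i $ j =
      (if p \<le> i \<and> q \<le> j then gf A $ (i - p) $ (j - q) else 0)"
    by (simp add: mult.assoc fps_const_power fps_X_power_mult_nth not_less)
  show "gf (f ` A) $ i $ j = (tvar ^ p * xvar ^ q * gf A) $ i $ j"
  proof (cases "p \<le> i \<and> q \<le> j")
    case True
    then have "slice (f ` A) i j = f ` slice A (i - p) (j - q)"
      using len sum by auto
    moreover have "inj_on f (slice A (i - p) (j - q))"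
      using assms(1) by (rule inj_on_subset) auto
    ultimately show ?thesis
      using True by (simp only: rhs gf_nth) (simp add: card_image)
  next
    case False
    then have "slice (f ` A) i j = {}"
      using len sum by auto
    then show ?thesis
      using False by (simp only: rhs gf_nth) simp
  qed
qed

lemma gf_Nil: "gf {[]} = 1"
proof (intro fps_ext)
  fix i j
  have "slice {[]} i j = (if i = 0 \<and> j = 0 then {[]} else {})"
    by auto
  then show "gf {[]} $ i $ j = 1 $ i $ j"
    by (simp add: gf_nth)
qed

lemma Nil_in_words [simp]: "[] \<in> words"
  and Cons_in_words [simp]: "m # w \<in> words \<longleftrightarrow> 1 \<le> m \<and> w \<in> words"
  by (simp_all add: words_def)

definition prepend_ge :: "nat \<Rightarrow> nat list set \<Rightarrow> nat list set" where
  "prepend_ge j A = {m # w | m w. j \<le> m \<and> w \<in> A}"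

lemma prepend_ge_subset_words:
  assumes "A \<subseteq> words" "1 \<le> j"
  shows "prepend_ge j A \<subseteq> words"
  using assms by (auto simp: prepend_ge_def)

text \<open>Geometric series in the first letter: a member either starts with \<open>j\<close> or
  arises from another member by raising its first letter by one, at the cost of a factor x. Hence
  its series G satisfies G = t x^j \<open>gf A\<close> + x G.\<close>

lemma gf_prepend_ge:
  assumes "A \<subseteq> words" "1 \<le> j"
  shows "(1 - xvar) * gf (prepend_ge j A) = tvar * xvar ^ j * gf A"
proof -
  define raise where "raise w = Suc (hd w) # tl w" for w
  let ?H = "prepend_ge j A"
  have split: "?H = (#) j ` A \<union> raise ` ?H"
  proof (intro equalityI subsetI)
    fix v assume "v \<in> ?H"
    then obtain m w where v: "v = m # w" "j \<le> m" "w \<in> A"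
      by (auto simp: prepend_ge_def)
    show "v \<in> (#) j ` A \<union> raise ` ?H"
    proof (cases "m = j")
      case False
      then have "v = raise ((m - 1) # w)" "(m - 1) # w \<in> ?H"
        using v by (auto simp: raise_def prepend_ge_def)
      then show ?thesis
        by blast
    qed (use v in auto)
  qed (auto simp: prepend_ge_def raise_def)
  have "(#) j ` A \<union> raise ` ?H \<subseteq> words"
    using prepend_ge_subset_words[OF assms] split by simp
  moreover have "(#) j ` A \<inter> raise ` ?H = {}"
    by (auto simp: prepend_ge_def raise_def)
  ultimately have "gf ?H = gf ((#) j ` A) + gf (raise ` ?H)"
    by (subst split, subst gf_Un) auto
  moreover have "gf ((#) j ` A) = tvar ^ 1 * xvar ^ j * gf A"
    by (rule gf_image) auto
  moreover have "gf (raise ` ?H) = tvar ^ 0 * xvar ^ 1 * gf ?H"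
    by (rule gf_image) (auto simp: prepend_ge_def raise_def intro!: inj_onI)
  ultimately show ?thesis
    by (simp add: algebra_simps)
qed

section \<open>The automaton\<close>

definition state :: "nat \<Rightarrow> nat list \<Rightarrow> nat" where
  "state k w = fold (\<lambda>m k. min (Suc k) m) w k"

lemma state_Nil [simp]: "state k [] = k"
  and state_Cons [simp]: "state k (m # w) = state (min (Suc k) m) w"
  and state_snoc [simp]: "state k (w @ [m]) = min (Suc (state k w)) m"
  by (simp_all add: state_def)

lemma suffix_dominates_snoc_iff:
  "(\<exists>a v. w @ [m] = a @ v \<and> list_all2 (\<le>) (u @ [n]) v) \<longleftrightarrow>
    n \<le> m \<and> (\<exists>a v. w = a @ v \<and> list_all2 (\<le>) u v)" (is "?L \<longleftrightarrow> ?R")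
proof
  assume ?L
  then obtain a v where "w @ [m] = a @ v" "list_all2 (\<le>) (u @ [n]) v"
    by blast
  moreover from this(2) obtain v' l where "v = v' @ [l]" "list_all2 (\<le>) u v'" "n \<le> l"
    by (auto simp: list_all2_append1 list_all2_Cons1)
  ultimately show ?R
    by auto
next
  assume ?R
  then obtain a v where "n \<le> m" "w = a @ v" "list_all2 (\<le>) u v"
    by blast
  then have "w @ [m] = a @ v @ [m]" "list_all2 (\<le>) (u @ [n]) (v @ [m])"
    by (auto intro: list_all2_appendI)
  then show ?L
    by blast
qed

text \<open>The bound n <= min (s + 1) m splits into n <= m and n - 1 <= s, exactly as the suffix
  condition splits at its last letter. The threshold drops by one, so \<open>n\<close> stays
  arbitrary in the induction.\<close>

lemma state_ge_iff:
  "n \<le> state 0 w \<longleftrightarrow> (\<exists>a v. w = a @ v \<and> list_all2 (\<le>) [1..<n + 1] v)"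
proof (induction w arbitrary: n rule: rev_induct)
  case Nil
  show ?case
    by (cases n) auto
next
  case (snoc m w)
  show ?case
  proof (cases n)
    case (Suc k)
    then have "[1..<n + 1] = [1..<k + 1] @ [n]"
      by simp
    then have "(\<exists>a v. w @ [m] = a @ v \<and> list_all2 (\<le>) [1..<n + 1] v) \<longleftrightarrow> n \<le> m \<and> k \<le> state 0 w"
      by (simp only: suffix_dominates_snoc_iff snoc.IH)
    then show ?thesis
      using Suc by (simp only: state_snoc min.bounded_iff Suc_le_mono conj_commute)
  qed auto
qed

text \<open>The final state is only bounded below, but a letter raises the state by at most one, so
  for k <= n the word ends at exactly n.\<close>

definition first_passage :: "nat \<Rightarrow> nat \<Rightarrow> nat list set" where
  "first_passage n k =
    {w \<in> words. n \<le> state k w \<and> (\<forall>p b. w = p @ b \<longrightarrow> b \<noteq> [] \<longrightarrow> state k p < n)}"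

lemma first_passage_subset_words: "first_passage n k \<subseteq> words"
  by (auto simp: first_passage_def)

text \<open>By \<open>state_ge_iff\<close>, embeddings with remainder \<open>b\<close> exist exactly
  when the prefix \<open>a @ v\<close> before \<open>b\<close> has state at least n. All of them are
  suffixes iff no proper prefix reaches n.\<close>

lemma suffix_words_eq_first_passage: "suffix_words [1..<n + 1] = first_passage n 0"
proof -
  let ?u = "[1..<n + 1]"
  have "(\<forall>a v b. is_embedding ?u w a v b \<longrightarrow> b = []) \<longleftrightarrow>
      (\<forall>p b. w = p @ b \<longrightarrow> b \<noteq> [] \<longrightarrow> state 0 p < n)" for w
    unfolding not_le[symmetric] state_ge_iff is_embedding_def by (metis append_assoc)
  moreover have "factor_le ?u w \<longleftrightarrow> (\<exists>p b. w = p @ b \<and> n \<le> state 0 p)" for w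
    unfolding state_ge_iff factor_le_def is_embedding_def by (metis append_assoc)
  ultimately show ?thesis
    unfolding suffix_words_def first_passage_def
    by (auto simp flip: not_less) (metis append_Nil2)
qed

lemma first_passage_self: "first_passage n n = {[]}"
  by (force simp: first_passage_def)

lemma Nil_in_first_passage_iff: "[] \<in> first_passage n k \<longleftrightarrow> n \<le> k"
  by (simp add: first_passage_def)

lemma Cons_in_first_passage_iff:
  assumes "k < n"
  shows "m # w \<in> first_passage n k \<longleftrightarrow> 1 \<le> m \<and> w \<in> first_passage n (min (Suc k) m)"
proof -
  have "(\<forall>p b. m # w = p @ b \<longrightarrow> b \<noteq> [] \<longrightarrow> state k p < n) \<longleftrightarrow>
      (\<forall>p b. w = p @ b \<longrightarrow> b \<noteq> [] \<longrightarrow> state (min (Suc k) m) p < n)"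
    using assms by (simp add: Cons_eq_append_conv all_conj_distrib) (metis state_Cons)
  then show ?thesis
    by (simp add: first_passage_def)
qed

lemma first_passage_decomp:
  assumes "k < n"
  shows "first_passage n k =
    {m # w | m w. 1 \<le> m \<and> m \<le> k \<and> w \<in> first_passage n m} \<union>
    prepend_ge (Suc k) (first_passage n (Suc k))" (is "_ = ?R")
proof (rule set_eqI)
  fix w show "w \<in> first_passage n k \<longleftrightarrow> w \<in> ?R"
    using assms by (cases w) (auto simp: prepend_ge_def Nil_in_first_passage_iff
        Cons_in_first_passage_iff min_def)
qed

lemma first_passage_0:
  assumes "0 < n"
  shows "first_passage n 0 = prepend_ge 1 (first_passage n 1)"
  using first_passage_decomp[OF assms] by auto

text \<open>A second cut of the same language, one letter higher: from state k the letter k + 1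
  leads to state k + 1, so it also fits the first part. That part now equals the one
  \<open>first_passage_decomp\<close> gives for state k + 1.\<close>

lemma first_passage_decomp_Suc:
  assumes "Suc k < n"
  shows "first_passage n k =
    {m # w | m w. 1 \<le> m \<and> m \<le> Suc k \<and> w \<in> first_passage n m} \<union>
    prepend_ge (Suc (Suc k)) (first_passage n (Suc k))" (is "_ = ?R")
proof (rule set_eqI)
  fix w show "w \<in> first_passage n k \<longleftrightarrow> w \<in> ?R"
    using assms by (cases w) (auto simp: prepend_ge_def Nil_in_first_passage_iff
        Cons_in_first_passage_iff min_def not_less_eq_eq le_Suc_eq)
qed

lemma gf_first_passage_0:
  assumes "0 < n"
  shows "(1 - xvar) * gf (first_passage n 0) = tvar * xvar * gf (first_passage n 1)"
  using gf_prepend_ge[of "first_passage n 1" 1] assms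
  by (simp add: first_passage_0 first_passage_subset_words)

lemma gf_first_passage_diff:
  assumes "Suc k < n"
  shows "(1 - xvar) * (gf (first_passage n (Suc k)) - gf (first_passage n k)) =
    tvar * xvar ^ (k + 2) * (gf (first_passage n (k + 2)) - gf (first_passage n (Suc k)))"
proof -
  let ?H = "\<lambda>i. prepend_ge (Suc (Suc k)) (first_passage n i)"
  \<comment> \<open>The part common to both states, which cancels in the difference; its first
    letters are too small for \<open>?H\<close>.\<close>
  define C where "C = {m # w | m w. 1 \<le> m \<and> m \<le> Suc k \<and> w \<in> first_passage n m}"
  have C: "C \<subseteq> words" "C \<inter> ?H i = {}" for i
    using first_passage_subset_words by (fastforce simp: C_def prepend_ge_def)+
  have H: "?H i \<subseteq> words" for i
    by (simp add: prepend_ge_subset_words first_passage_subset_words)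
  have "first_passage n (Suc k) = C \<union> ?H (k + 2)"
    using first_passage_decomp[OF assms] by (simp add: C_def)
  then have 1: "gf (first_passage n (Suc k)) = gf C + gf (?H (k + 2))"
    using gf_Un C H by metis
  have "first_passage n k = C \<union> ?H (Suc k)"
    using first_passage_decomp_Suc[OF assms] by (simp add: C_def)
  then have 2: "gf (first_passage n k) = gf C + gf (?H (Suc k))"
    using gf_Un C H by metis
  have 3: "(1 - xvar) * gf (?H i) = tvar * xvar ^ (k + 2) * gf (first_passage n i)" for i
    using gf_prepend_ge[OF first_passage_subset_words, of "Suc (Suc k)"] by simp
  have "(1 - xvar) * (gf (first_passage n (Suc k)) - gf (first_passage n k)) =
      (1 - xvar) * gf (?H (k + 2)) - (1 - xvar) * gf (?H (Suc k))"
    by (subst 1, subst 2) (simp add: algebra_simps)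
  then show ?thesis
    unfolding 3 by (simp add: right_diff_distrib)
qed

section \<open>Solving the recurrence\<close>

text \<open>The placeholder values at 0 and 1 obey the recurrence too: 1 - x^k vanishes for k = 0
  and supplies the second factor 1 - x of \<open>B 2\<close> for k = 1. So the induction below can
  start at 0.\<close>

lemma B_Suc: "B (Suc k) t x = t * x ^ Suc k * B k t x + t * x * (1 - x) ^ k * (1 - x ^ k)"
proof -
  consider "k = 0" | "k = 1" | "k \<ge> 2"
    by linarith
  then show ?thesis
  proof cases
    case 3
    then show ?thesis
      using B_rec[of k t x] by simp
  qed (simp_all add: power2_eq_square)
qed

lemma Suc_choose_2: "Suc n choose 2 = n + (n choose 2)"
  by (simp only: numeral_2_eq_2 binomial_Suc_Suc binomial_1)

lemma recurrence_solution:
  fixes F :: "nat \<Rightarrow> 'a::comm_ring_1"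
  assumes init: "(1 - x) * F 0 = t * x * F 1"
    and step: "\<And>k. Suc k < n \<Longrightarrow>
      (1 - x) * (F (Suc k) - F k) = t * x ^ (k + 2) * (F (k + 2) - F (Suc k))"
    and "k \<le> n"
  shows "t ^ k * x ^ (Suc k choose 2) * F k = ((1 - x) ^ k - B k t x) * F 0"
  using \<open>k \<le> n\<close>
proof (induction k rule: induct_nat_012)
  case 0
  show ?case by (simp add: binomial_eq_0)
next
  case 1
  show ?case using init by (simp add: Suc_choose_2 binomial_eq_0)
next
  case (ge2 k)
  define P where "P k = t ^ k * x ^ (Suc k choose 2)" for k
  define Q where "Q k = (1 - x) ^ k - B k t x" for k
  have P_Suc: "P (Suc k) = t * x ^ Suc k * P k" for k
    by (simp only: P_def Suc_choose_2[of "Suc k"] power_add power_Suc mult_ac)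
  \<comment> \<open>The defect Q (k + 1) - t x^(k+1) Q k is (1 - x - t x) (1 - x)^k, which gains
    just a factor 1 - x when k grows by one. This closes the induction.\<close>
  have Q_Suc: "Q (Suc k) = t * x ^ Suc k * Q k + (1 - x - t * x) * (1 - x) ^ k" for k
    by (simp add: Q_def B_Suc algebra_simps)
  have IH: "P k * F k = Q k * F 0" "P (Suc k) * F (Suc k) = Q (Suc k) * F 0"
    using ge2 by (simp_all add: P_def Q_def)
  have "(1 - x) * (F (Suc k) - F k) =
      t * x ^ Suc (Suc k) * (F (Suc (Suc k)) - F (Suc k))"
    using step[of k] ge2.prems by simp
  then have step': "t * x ^ Suc (Suc k) * F (Suc (Suc k)) =
      t * x ^ Suc (Suc k) * F (Suc k) + (1 - x) * (F (Suc k) - F k)"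
    by (simp only: right_diff_distrib[of "t * x ^ Suc (Suc k)"] add_diff_cancel_left' add_diff_eq)
  \<comment> \<open>\<open>P\<close> releases the factor t x^(k+2), so \<open>step'\<close> applies
    without division and any commutative ring will do.\<close>
  have "P (Suc (Suc k)) * F (Suc (Suc k)) =
      P (Suc k) * (t * x ^ Suc (Suc k) * F (Suc (Suc k)))"
    by (simp add: P_Suc[of "Suc k"] mult_ac)
  also have "\<dots> = (t * x ^ Suc (Suc k) + (1 - x)) * (P (Suc k) * F (Suc k)) -
      (1 - x) * (P (Suc k) * F k)"
    by (simp only: step') (simp add: algebra_simps)
  also have "\<dots> = (t * x ^ Suc (Suc k) + (1 - x)) * (P (Suc k) * F (Suc k)) -
      (1 - x) * (t * x ^ Suc k) * (P k * F k)"
    by (simp add: P_Suc[of k] mult_ac)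
  also have "\<dots> = (t * x ^ Suc (Suc k) * Q (Suc k) +
      (1 - x) * (Q (Suc k) - t * x ^ Suc k * Q k)) * F 0"
    by (simp only: IH) (simp add: algebra_simps)
  also have "\<dots> = Q (Suc (Suc k)) * F 0"
    by (simp only: Q_Suc[of "Suc k"] Q_Suc[of k] add_diff_cancel_left' power_Suc mult_ac)
  finally show ?case
    by (simp only: P_def Q_def)
qed

theorem theorem6p1:
  fixes n :: nat
  assumes "n \<ge> 2"
  shows "S [1..<n + 1] =
    tvar ^ n * xvar ^ ((n + 1) choose 2) / ((1 - xvar) ^ n - B n tvar xvar)"
proof -
  let ?F = "\<lambda>k. gf (first_passage n k)"
  let ?D = "(1 - xvar) ^ n - B n tvar xvar :: rat fps fps"
  let ?N = "tvar ^ n * xvar ^ ((n + 1) choose 2) :: rat fps fps"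
  have "?N * ?F n = ?D * ?F 0"
    using recurrence_solution[of xvar ?F tvar n n] gf_first_passage_0[of n]
      gf_first_passage_diff[of _ n] assms by simp
  then have "S [1..<n + 1] * ?D = ?N"
    by (simp only: S_def suffix_words_eq_first_passage first_passage_self gf_Nil
        mult_1_left mult_1_right mult.commute)
  \<comment> \<open>The denominator has constant term 1, so the library division is a true quotient
    and \<open>?D\<close> can be cancelled.\<close>
  also have "\<dots> = ?N / ?D * ?D"
    by (rule bivariate_divide_mult[symmetric]) (metis denominator_unit zero_neq_one)
  finally have "S [1..<n + 1] * ?D = ?N / ?D * ?D" .
  moreover have "?D \<noteq> 0"
    using denominator_unit[of n] by auto
  ultimately show ?thesis
    using mult_right_cancel by blast
qed

end
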